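(* Let $n,N\ge1$ be integers. For all $\mathbf m,\mathbf m'\in\hat D_N^n$, $$\sum_{\mathbf s\in(F_N^-)^n}\sin^-_{\mathbf m}(\mathbf s)\,\sin^-_{\mathbf m'}(\mathbf s)=|S_n|\sum_{\mathbf s\in\hat F_N^n}\sin^-_{\mathbf m}(\mathbf s)\,\sin^-_{\mathbf m'}(\mathbf s)=\Big(\frac N2\Big)^n\delta_{\mathbf m\mathbf m'} .$$
   Context: $F_N^-=\{\frac1N,\frac2N,\dots,\frac{N-1}N\}$; $\hat F_N^n$ is the set of $\mathbf s=(s_1,\dots,s_n)\in(F_N^-)^n$ with $s_1>s_2>\cdots>s_n$; $\hat D_N^n$ is the set of integer $n$-tuples $\mathbf m=(m_1,\dots,m_n)$ with $N>m_1>m_2>\cdots>m_n>0$. $|S_n|=n!$ is the order of the symmetric group. The discrete functions are $\sin^-_{\mathbf m}(\mathbf s)=|S_n|^{-1/2}\det(\sin\pi m_is_j)_{i,j=1}^n$. *)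

theory Defs
  imports Complex_Main "Jordan_Normal_Form.Determinant"
begin

(* n-tuples are vectors of dimension n, with indices 0, ..., n - 1 in place of 1, ..., n. *)

definition F_grid :: "nat \<Rightarrow> real set" where
  "F_grid N = {real k / real N | k. 1 \<le> k \<and> k < N}"

definition F_grid_pow :: "nat \<Rightarrow> nat \<Rightarrow> real vec set" where
  "F_grid_pow N n = {s \<in> carrier_vec n. \<forall>i<n. s $ i \<in> F_grid N}"

definition strictly_decreasing_vec :: "'a::linorder vec \<Rightarrow> bool" where
  "strictly_decreasing_vec v \<longleftrightarrow> (\<forall>i j. i < j \<and> j < dim_vec v \<longrightarrow> v $ i > v $ j)"

definition F_hat :: "nat \<Rightarrow> nat \<Rightarrow> real vec set" where
  "F_hat N n = {s \<in> F_grid_pow N n. strictly_decreasing_vec s}"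

definition D_hat :: "nat \<Rightarrow> nat \<Rightarrow> int vec set" where
  "D_hat N n = {m \<in> carrier_vec n.
     (\<forall>i<n. 0 < m $ i \<and> m $ i < int N) \<and> strictly_decreasing_vec m}"

definition sym_order :: "nat \<Rightarrow> nat" where
  "sym_order n = card {p. p permutes {0..<n}}"

definition sin_minus :: "nat \<Rightarrow> int vec \<Rightarrow> real vec \<Rightarrow> real" where
  "sin_minus n m s = real (sym_order n) powr (- 1 / 2) *
     det (mat n n (\<lambda>(i, j). sin (pi * of_int (m $ i) * s $ j)))"

end

theory Submission
  imports Defs
begin

text \<open>
  By the Andreief (Cauchy--Binet) identity, the sum over all grid points of a product of two
  determinants is \<open>n!\<close> times the determinant of the Gram matrix of the one-dimensional functions,
  and the discrete sine functions are orthogonal on the grid, so that this matrix is \<open>N/2\<close> times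
  the identity if \<open>m = m'\<close> and no term of its Leibniz expansion survives otherwise. The restriction
  to decreasing grid points uses that the summand is invariant under permutations of the
  coordinates and vanishes if two coordinates agree.
\<close>

section \<open>Orthogonality of the discrete sines\<close>

text \<open>The factor \<open>2 * sin (x / 2)\<close> turns each cosine into the difference of the
  sines at \<open>(k + 1/2) * x\<close> and \<open>(k - 1/2) * x\<close>, so the sum
  telescopes.\<close>

lemma sin_half_times_cos_sum:
  fixes x :: real
  shows "2 * sin (x / 2) * (\<Sum>k=1..<Suc n. cos (real k * x)) = sin ((real n + 1 / 2) * x) - sin (x / 2)"
proof (induction n)
  case 0
  then show ?case by simp
next
  case (Suc n)
  have "2 * sin (x / 2) * cos (real (Suc n) * x)
      = sin (real (Suc n) * x + x / 2) - sin (real (Suc n) * x - x / 2)"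
    by (simp add: sin_add sin_diff)
  also have "\<dots> = sin ((real (Suc n) + 1 / 2) * x) - sin ((real n + 1 / 2) * x)"
    by (simp add: algebra_simps)
  finally show ?case
    using Suc.IH by (simp add: algebra_simps)
qed

text \<open>The bounds on \<open>c\<close> put half the angle \<open>x = pi * c / N\<close> strictly
  between 0 and \<open>pi\<close>, so \<open>sin (x / 2)\<close> can be cancelled from the
  telescoped sum.\<close>

lemma cos_sum_grid:
  fixes c :: int
  assumes "0 < c" "c < 2 * int N"
  shows "(\<Sum>k=1..<N. cos (pi * of_int c * (real k / real N))) = (- 1 - cos (pi * of_int c)) / 2"
proof -
  define x where "x = pi * of_int c / real N"
  obtain n where N: "N = Suc n"
    using assms by (cases N) auto
  have "0 < x / 2" "x / 2 < pi"
  proof -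
    have "0 < real_of_int c" "real_of_int c < 2 * real N"
      using assms by linarith+
    then have "0 < pi * real_of_int c" "pi * real_of_int c < pi * (2 * real N)"
      by simp_all
    then show "0 < x / 2" "x / 2 < pi"
      by (simp_all add: x_def N field_simps)
  qed
  then have nz: "sin (x / 2) \<noteq> 0"
    using sin_gt_zero[of "x / 2"] by simp
  \<comment> \<open>As \<open>N = Suc n\<close>, the angle is \<open>N * x - x / 2\<close> with
    \<open>N * x = pi * c\<close>, and \<open>sin (pi * c) = 0\<close>.\<close>
  have "(real n + 1 / 2) * x = pi * of_int c - x / 2"
    by (simp add: x_def N field_simps)
  then have "sin ((real n + 1 / 2) * x) = - cos (pi * of_int c) * sin (x / 2)"
    by (simp add: sin_diff sin_zero_iff_int2 mult.commute)
  then have "sin (x / 2) * (2 * (\<Sum>k=1..<N. cos (real k * x))) = sin (x / 2) * (- 1 - cos (pi * of_int c))"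
    using sin_half_times_cos_sum[of x n] by (simp add: N algebra_simps)
  then have "2 * (\<Sum>k=1..<N. cos (real k * x)) = - 1 - cos (pi * of_int c)"
    using nz by (simp only: mult_cancel_left) simp
  then show ?thesis
    by (simp add: x_def mult_ac)
qed

lemma F_grid_image: "F_grid N = (\<lambda>k. real k / real N) ` {1..<N}"
  by (auto simp: F_grid_def)

lemma sum_F_grid: "sum f (F_grid N) = (\<Sum>k=1..<N. f (real k / real N))"
proof -
  have "inj_on (\<lambda>k. real k / real N) {1..<N}"
    by (auto simp: inj_on_def)
  then show ?thesis
    by (simp add: F_grid_image sum.reindex)
qed

lemma finite_F_grid: "finite (F_grid N)"
  by (simp add: F_grid_image)

text \<open>Product-to-sum leaves cosine sums of frequencies \<open>a - b\<close> and
  \<open>a + b\<close>. These have the same parity, so for \<open>a\<close> different from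
  \<open>b\<close> both sums have the same closed form and cancel.\<close>

lemma discrete_sine_orthogonality:
  fixes a b :: int
  assumes a: "0 < a" "a < int N" and b: "0 < b" "b < int N"
  shows "(\<Sum>t\<in>F_grid N. sin (pi * of_int a * t) * sin (pi * of_int b * t))
    = (if a = b then real N / 2 else 0)"
proof -
  let ?C = "\<lambda>c :: int. \<Sum>k=1..<N. cos (pi * of_int c * (real k / real N))"
  have "(\<Sum>t\<in>F_grid N. sin (pi * of_int a * t) * sin (pi * of_int b * t))
      = (\<Sum>k=1..<N. (cos (pi * of_int (a - b) * (real k / real N))
                      - cos (pi * of_int (a + b) * (real k / real N))) / 2)"
    unfolding sum_F_grid sin_times_sin
    by (intro sum.cong refl) (simp add: algebra_simps diff_divide_distrib add_divide_distrib)
  also have "\<dots> = (?C \<bar>a - b\<bar> - ?C (a + b)) / 2"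
  proof -
    \<comment> \<open>The absolute value makes the frequency positive, as
      \<open>cos_sum_grid\<close> requires when \<open>a\<close> and \<open>b\<close>
      differ.\<close>
    have "cos (pi * of_int (a - b) * y) = cos (pi * of_int \<bar>a - b\<bar> * y)" for y
      by (cases "a \<ge> b") (simp_all add: abs_if algebra_simps cos_diff)
    then show ?thesis
      by (simp only: sum_subtractf flip: sum_divide_distrib)
  qed
  also have "?C (a + b) = (- 1 - cos (pi * of_int (a + b))) / 2"
    using a b by (intro cos_sum_grid) auto
  also have "cos (pi * of_int (a + b)) = cos (pi * of_int \<bar>a - b\<bar>)"
    by (cases "a \<ge> b") (simp_all add: abs_if algebra_simps cos_diff cos_add sin_zero_iff_int2)
  finally have *: "(\<Sum>t\<in>F_grid N. sin (pi * of_int a * t) * sin (pi * of_int b * t))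
      = (?C \<bar>a - b\<bar> - (- 1 - cos (pi * of_int \<bar>a - b\<bar>)) / 2) / 2" .
  show ?thesis
  proof (cases "a = b")
    case True
    \<comment> \<open>Here the first sum consists of \<open>N - 1\<close> ones and the second equals
      -1, so half their difference is \<open>N / 2\<close>.\<close>
    have "real (N - Suc 0) = real N - 1"
      using a by simp
    then show ?thesis
      using True * by (simp add: field_simps)
  next
    case False
    then have "?C \<bar>a - b\<bar> = (- 1 - cos (pi * of_int \<bar>a - b\<bar>)) / 2"
      using a b by (intro cos_sum_grid) auto
    then show ?thesis
      unfolding * using False by simp
  qed
qed

section \<open>The discrete Andreief identity\<close>

text \<open>This is distributivity: expanding the product of sums chooses an element of
  \<open>T\<close> for each index, and such choice functions correspond to vectors over
  \<open>T\<close>.\<close>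

lemma sum_vec_prod:
  fixes f :: "nat \<Rightarrow> 'a \<Rightarrow> 'b::comm_semiring_1"
  assumes "finite T"
  shows "(\<Sum>s\<in>{s \<in> carrier_vec n. \<forall>i<n. s $ i \<in> T}. \<Prod>i=0..<n. f i (s $ i)) = (\<Prod>i=0..<n. \<Sum>t\<in>T. f i t)"
proof -
  have "(\<Prod>i=0..<n. \<Sum>t\<in>T. f i t) = (\<Sum>g\<in>{0..<n} \<rightarrow>\<^sub>E T. \<Prod>i=0..<n. f i (g i))"
    by (rule prod_sum_PiE) (use assms in auto)
  also have "\<dots> = (\<Sum>s\<in>{s \<in> carrier_vec n. \<forall>i<n. s $ i \<in> T}. \<Prod>i=0..<n. f i (s $ i))"
    by (rule sum.reindex_bij_witness[where i = "\<lambda>s. restrict (($) s) {0..<n}" and j = "vec n"])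
       (auto simp: PiE_iff extensional_def fun_eq_iff)
  finally show ?thesis ..
qed

text \<open>The permutation acts on the row index, so that the i-th factor depends on
  \<open>s $ i\<close> alone and \<open>sum_vec_prod\<close> applies.\<close>

lemma det_of_columns:
  fixes f :: "nat \<Rightarrow> 'a \<Rightarrow> 'b::comm_ring_1"
  shows "det (mat n n (\<lambda>(i, j). f i (s $ j)))
    = (\<Sum>p | p permutes {0..<n}. signof p * (\<Prod>i=0..<n. f (p i) (s $ i)))"
proof (subst det_col[where n = n], force, intro sum.cong refl)
  fix p assume "p \<in> {p. p permutes {0..<n}}"
  then have "p i < n" if "i < n" for i
    using that permutes_in_image[of p "{0..<n}" i] by simp
  then show "signof p * (\<Prod>j<n. mat n n (\<lambda>(i, j). f i (s $ j)) $$ (p j, j))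
      = signof p * (\<Prod>i=0..<n. f (p i) (s $ i))"
    by (simp add: lessThan_atLeast0)
qed

lemma andreief:
  fixes f g :: "nat \<Rightarrow> 'a \<Rightarrow> 'b::comm_ring_1"
  assumes T: "finite T"
  shows "(\<Sum>s\<in>{s \<in> carrier_vec n. \<forall>i<n. s $ i \<in> T}.
      det (mat n n (\<lambda>(i, j). f i (s $ j))) * det (mat n n (\<lambda>(i, j). g i (s $ j))))
    = of_nat (card {p. p permutes {0..<n}}) * det (mat n n (\<lambda>(i, j). \<Sum>t\<in>T. f i t * g j t))"
    (is "sum ?h ?S = _ * det ?G")
proof -
  let ?P = "{p. p permutes {0..<n}}"
  have P_lt: "p i < n" if "p \<in> ?P" "i < n" for p i
    using that permutes_in_image[of p "{0..<n}" i] by simp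
  have "sum ?h ?S = (\<Sum>s\<in>?S. \<Sum>p\<in>?P. \<Sum>q\<in>?P.
      signof p * signof q * (\<Prod>i=0..<n. f (p i) (s $ i) * g (q i) (s $ i)))"
    unfolding det_of_columns sum_product prod.distrib by (simp add: mult_ac)
  also have "\<dots> = (\<Sum>p\<in>?P. \<Sum>q\<in>?P. \<Sum>s\<in>?S.
      signof p * signof q * (\<Prod>i=0..<n. f (p i) (s $ i) * g (q i) (s $ i)))"
    by (subst sum.swap) (intro sum.cong refl sum.swap)
  also have "\<dots> = (\<Sum>p\<in>?P. \<Sum>q\<in>?P. signof p * signof q *
      (\<Prod>i=0..<n. \<Sum>t\<in>T. f (p i) t * g (q i) t))"
    by (simp add: sum_vec_prod[OF T, of "\<lambda>i t. f (_ i) t * g (_ i) t"] flip: sum_distrib_left)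
  \<comment> \<open>For fixed \<open>p\<close>, the sum over \<open>q\<close> is the Leibniz
    expansion of the Gram matrix with rows permuted by \<open>p\<close>. Its sign cancels
    \<open>signof p\<close>, so every \<open>p\<close> contributes the same determinant.\<close>
  also have "\<dots> = (\<Sum>p\<in>?P. signof p * det (mat n n (\<lambda>(i, j). ?G $$ (p i, j))))"
    unfolding det_def'[OF mat_carrier] sum_distrib_left
    by (intro sum.cong refl) (simp add: P_lt mult.assoc)
  also have "\<dots> = (\<Sum>p\<in>?P. signof p * (signof p * det ?G))"
    by (intro sum.cong refl) (simp add: det_permute_rows[of _ n])
  also have "\<dots> = (\<Sum>p\<in>?P. det ?G)"
    by (intro sum.cong refl) (simp add: sign_def)
  finally show ?thesis by simp
qed

section \<open>Decreasing rearrangements\<close>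

lemma permutes_strict_mono_imp_id:
  fixes p :: "nat \<Rightarrow> nat"
  assumes p: "p permutes {0..<n}" and mono: "\<And>i j. i < j \<Longrightarrow> j < n \<Longrightarrow> p i < p j"
  shows "p = id"
proof
  fix i
  show "p i = id i"
  proof (induction i rule: less_induct)
    case (less i)
    show ?case
    proof (cases "i < n")
      case True
      obtain j where j: "p j = i"
        using permutes_surj[OF p] by (metis surjD)
      have "j < n"
        using permutes_in_image[OF p, of j] j True by simp
      consider "j < i" | "j = i" | "i < j" by linarith
      then show ?thesis
      proof cases
        case 1
        then show ?thesis
          using less.IH[of j] j by simp
      next
        case 3
        \<comment> \<open>The value \<open>p i\<close> is a smaller index, hence a fixed point by
          induction; injectivity then gives \<open>p i = i\<close>.\<close>
        then have "p i < i"
          using mono[of i j] j \<open>j < n\<close> by simp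
        then have "p (p i) = p i"
          using less.IH by simp
        then show ?thesis
          using permutes_inj[OF p] by (simp add: inj_eq)
      qed (use j in simp)
    qed (use p in \<open>simp add: permutes_def\<close>)
  qed
qed

text \<open>Order in both vectors reflects index order, so \<open>p\<close> must be increasing. This
  gives both the uniqueness of decreasing rearrangements and the vanishing of Leibniz terms in the
  Gram determinant.\<close>

lemma strictly_decreasing_vec_permute_id:
  assumes "strictly_decreasing_vec s" "strictly_decreasing_vec s'"
    and "dim_vec s = n" "dim_vec s' = n" and p: "p permutes {0..<n}"
    and eq: "\<And>i. i < n \<Longrightarrow> s $ i = s' $ p i"
  shows "p = id"
proof (rule permutes_strict_mono_imp_id[OF p])
  fix i j assume ij: "i < j" "j < n"
  then have "s $ j < s $ i"
    using assms(1,3) by (simp add: strictly_decreasing_vec_def)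
  then have lt: "s' $ p j < s' $ p i"
    using ij by (simp add: eq)
  have "p i < n"
    using ij permutes_in_image[OF p, of i] by simp
  then have "\<not> p j < p i"
    using lt assms(2,4) order.asym unfolding strictly_decreasing_vec_def by blast
  moreover have "p j \<noteq> p i"
    using lt by auto
  ultimately show "p i < p j" by simp
qed

lemma distinct_vec_sort:
  fixes v :: "'a::linorder vec"
  assumes v: "v \<in> carrier_vec n" and inj: "inj_on (($) v) {0..<n}"
  obtains s p where "s \<in> carrier_vec n" "strictly_decreasing_vec s" "p permutes {0..<n}"
    "v = vec n (\<lambda>i. s $ p i)"
proof -
  define ys where "ys = rev (sort (list_of_vec v))"
  have len: "length ys = n"
    using v by (simp add: ys_def)
  have "distinct (list_of_vec v)"
    using inj v by (auto simp: distinct_conv_nth inj_on_def list_of_vec_index)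
  then have "sorted_wrt (>) ys"
    by (simp add: ys_def sorted_wrt_rev strict_sorted_iff)
  then have dec: "strictly_decreasing_vec (vec_of_list ys)"
    by (auto simp: strictly_decreasing_vec_def vec_of_list_index intro: sorted_wrt_nth_less)
  have "mset (list_of_vec v) = mset ys"
    by (simp add: ys_def)
  \<comment> \<open>Sorting preserves the multiset, and \<open>permute_list\<close> reads entry
    \<open>p i\<close> of the sorted list at position \<open>i\<close>.\<close>
  then obtain p where p: "p permutes {..<length ys}" "permute_list p ys = list_of_vec v"
    by (rule mset_eq_permutation)
  have "v = vec n (\<lambda>i. vec_of_list ys $ p i)"
  proof
    fix i assume "i < dim_vec (vec n (\<lambda>i. vec_of_list ys $ p i))"
    then have i: "i < n" by simp
    have "v $ i = permute_list p ys ! i"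
      by (simp add: p(2) list_of_vec_index)
    then show "v $ i = vec n (\<lambda>i. vec_of_list ys $ p i) $ i"
      using i len p(1) by (simp add: permute_list_nth vec_of_list_index)
  qed (use v in simp)
  then show ?thesis
    using that[of "vec_of_list ys" p] dec p(1) len
    by (simp add: lessThan_atLeast0 carrier_vecI)
qed

text \<open>Permutations act freely on tuples with distinct entries, and each orbit contains exactly
  one decreasing tuple. Tuples with a repeated entry contribute zero.\<close>

lemma sum_symmetric_eq_sum_decreasing:
  fixes h :: "'a::linorder vec \<Rightarrow> 'b::comm_semiring_1"
  assumes T: "finite T"
    and sym: "\<And>s p. s \<in> carrier_vec n \<Longrightarrow> p permutes {0..<n} \<Longrightarrow> h (vec n (\<lambda>i. s $ p i)) = h s"
    and van: "\<And>s. s \<in> carrier_vec n \<Longrightarrow> \<not> inj_on (($) s) {0..<n} \<Longrightarrow> h s = 0"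
  shows "sum h {s \<in> carrier_vec n. \<forall>i<n. s $ i \<in> T} = of_nat (card {p. p permutes {0..<n}}) *
    sum h {s \<in> {s \<in> carrier_vec n. \<forall>i<n. s $ i \<in> T}. strictly_decreasing_vec s}"
    (is "sum h ?S = of_nat (card ?P) * sum h ?D")
proof -
  let ?act = "\<lambda>(p, s). vec n (\<lambda>i. s $ p i)"
  let ?I = "{s \<in> ?S. inj_on (($) s) {0..<n}}"
  have P_lt: "p i < n" if "p permutes {0..<n}" "i < n" for p i
    using that permutes_in_image[of p "{0..<n}" i] by simp
  have fin: "finite ?S"
  proof (rule finite_subset)
    show "?S \<subseteq> vec n ` ({0..<n} \<rightarrow>\<^sub>E T)"
    proof
      fix s assume "s \<in> ?S"
      then have "s = vec n (restrict (($) s) {0..<n})" "restrict (($) s) {0..<n} \<in> {0..<n} \<rightarrow>\<^sub>E T"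
        by auto
      then show "s \<in> vec n ` ({0..<n} \<rightarrow>\<^sub>E T)" by blast
    qed
  qed (use T in \<open>simp add: finite_PiE\<close>)
  have inj: "inj_on ?act (?P \<times> ?D)"
  proof (rule inj_onI, clarify)
    fix p q and s s' :: "'a vec"
    assume p: "p permutes {0..<n}" and q: "q permutes {0..<n}"
      and s: "s \<in> carrier_vec n" "strictly_decreasing_vec s"
      and s': "s' \<in> carrier_vec n" "strictly_decreasing_vec s'"
      and eq: "vec n (\<lambda>i. s $ p i) = vec n (\<lambda>i. s' $ q i)"
    \<comment> \<open>If two pairs have the same image, this composite rearranges \<open>s'\<close>
      into \<open>s\<close>; both are decreasing, so it is the identity.\<close>
    have r: "q \<circ> inv_into UNIV p permutes {0..<n}"
      using p q by (intro permutes_compose permutes_inv)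
    have *: "s $ i = s' $ (q \<circ> inv_into UNIV p) i" if "i < n" for i
    proof -
      have "inv_into UNIV p i < n"
        using P_lt[OF permutes_inv[OF p] that] .
      then show ?thesis
        using arg_cong[OF eq, of "\<lambda>v. v $ inv_into UNIV p i"] by (simp add: permutes_inverses[OF p])
    qed
    have id: "q \<circ> inv_into UNIV p = id"
      using s s' r * by (intro strictly_decreasing_vec_permute_id[of s s' n]) auto
    then have "p = q"
      using p by (metis comp_assoc comp_id id_comp permutes_inv_o(2))
    moreover have "s = s'"
      using s s' * id by (intro eq_vecI) auto
    ultimately show "p = q \<and> s = s'" by simp
  qed
  have img: "?act ` (?P \<times> ?D) = ?I"
  proof (intro equalityI subsetI)
    fix v assume "v \<in> ?act ` (?P \<times> ?D)"
    then obtain p s where p: "p permutes {0..<n}" and s: "s \<in> ?D" and v: "v = vec n (\<lambda>i. s $ p i)"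
      by auto
    have "inj_on (($) s) {0..<n}"
      using s by (intro linorder_inj_onI) (fastforce simp: strictly_decreasing_vec_def)+
    then have "inj_on (\<lambda>i. s $ p i) {0..<n}"
      using comp_inj_on[of p "{0..<n}" "($) s"] permutes_inj_on[OF p] permutes_image[OF p]
      by (simp add: o_def)
    then have "inj_on (($) v) {0..<n}"
      by (simp add: v inj_on_def)
    then show "v \<in> ?I"
      using s P_lt[OF p] by (auto simp: v)
  next
    fix v assume v: "v \<in> ?I"
    then obtain s p where s: "s \<in> carrier_vec n" "strictly_decreasing_vec s"
      and p: "p permutes {0..<n}" and eq: "v = vec n (\<lambda>i. s $ p i)"
      using distinct_vec_sort[of v n] by auto
    have "s $ i \<in> T" if "i < n" for i
    proof -
      have "s $ i = v $ inv_into UNIV p i" "inv_into UNIV p i < n"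
        using P_lt[OF permutes_inv[OF p] that] by (simp_all add: eq permutes_inverses[OF p])
      then show ?thesis
        using v by auto
    qed
    then show "v \<in> ?act ` (?P \<times> ?D)"
      using s p eq by force
  qed
  have "sum h ?S = sum h ?I"
    using fin van by (intro sum.mono_neutral_right) auto
  also have "\<dots> = (\<Sum>x\<in>?P \<times> ?D. h (?act x))"
    unfolding img[symmetric] by (simp only: sum.reindex[OF inj] o_def)
  also have "\<dots> = (\<Sum>x\<in>?P \<times> ?D. h (snd x))"
    by (intro sum.cong refl) (auto simp: sym)
  also have "\<dots> = (\<Sum>p\<in>?P. \<Sum>s\<in>?D. h s)"
    by (simp only: sum.cartesian_product) (simp add: split_beta)
  finally show ?thesis by simp
qed

section \<open>Antisymmetry of the sine determinants\<close>

lemma det_permute_arguments: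
  fixes f :: "nat \<Rightarrow> 'a \<Rightarrow> 'b::comm_ring_1"
  assumes p: "p permutes {0..<n}"
  shows "det (mat n n (\<lambda>(i, j). f i (vec n (\<lambda>k. s $ p k) $ j)))
    = signof p * det (mat n n (\<lambda>(i, j). f i (s $ j)))"
proof -
  \<comment> \<open>The arguments index columns; transposing turns the rearrangement into a row
    permutation.\<close>
  let ?A = "mat n n (\<lambda>(j, i). f i (s $ j))"
  have p_lt: "p i < n" if "i < n" for i
    using that permutes_in_image[OF p, of i] by simp
  have "mat n n (\<lambda>(i, j). f i (vec n (\<lambda>k. s $ p k) $ j))
      = transpose_mat (mat n n (\<lambda>(i, j). ?A $$ (p i, j)))"
    by (rule eq_matI) (auto simp: p_lt)
  moreover have "mat n n (\<lambda>(i, j). f i (s $ j)) = transpose_mat ?A"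
    by (rule eq_matI) auto
  ultimately show ?thesis
    by (simp add: det_transpose[of _ n] det_permute_rows[OF _ p])
qed

lemma det_repeated_argument:
  fixes f :: "nat \<Rightarrow> 'a \<Rightarrow> 'b::comm_ring_1"
  assumes "\<not> inj_on (($) s) {0..<n}"
  shows "det (mat n n (\<lambda>(i, j). f i (s $ j))) = 0"
proof -
  let ?A = "mat n n (\<lambda>(j, i). f i (s $ j))"
  obtain i j where ij: "i < n" "j < n" "i \<noteq> j" "s $ i = s $ j"
    using assms by (auto simp: inj_on_def)
  have "det ?A = 0"
    using ij by (intro det_identical_rows[of _ n i j]) auto
  moreover have "mat n n (\<lambda>(i, j). f i (s $ j)) = transpose_mat ?A"
    by (rule eq_matI) auto
  ultimately show ?thesis
    by (simp add: det_transpose[of _ n])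
qed

section \<open>Normalization, Gram determinant and conclusion\<close>

lemma sin_minus_mult:
  "sin_minus n m s * sin_minus n m' s = inverse (real (sym_order n)) *
    (det (mat n n (\<lambda>(i, j). sin (pi * of_int (m $ i) * s $ j))) *
     det (mat n n (\<lambda>(i, j). sin (pi * of_int (m' $ i) * s $ j))))"
proof -
  have sq: "real (sym_order n) powr (- 1 / 2) * real (sym_order n) powr (- 1 / 2) = inverse (real (sym_order n))"
    unfolding powr_add[symmetric] by (simp add: powr_minus)
  show ?thesis
    unfolding sin_minus_def sq[symmetric] by (simp only: mult_ac)
qed

text \<open>By orthogonality the entries are \<open>N / 2\<close> or 0. For \<open>m = m'\<close>
  the matrix is scalar, since the entries of \<open>m\<close> are distinct. Otherwise a nonzero
  Leibniz term would match \<open>m\<close> with a permutation of \<open>m'\<close>, forcing that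
  permutation to be the identity and \<open>m = m'\<close>.\<close>

lemma det_sine_gram:
  assumes m: "m \<in> D_hat N n" and m': "m' \<in> D_hat N n"
  shows "det (mat n n (\<lambda>(i, j). \<Sum>t\<in>F_grid N. sin (pi * of_int (m $ i) * t) * sin (pi * of_int (m' $ j) * t)))
    = (real N / 2) ^ n * (if m = m' then 1 else 0)"
proof -
  have carrier: "dim_vec m = n" "dim_vec m' = n"
    and dec: "strictly_decreasing_vec m" "strictly_decreasing_vec m'"
    using m m' by (auto simp: D_hat_def)
  let ?G = "mat n n (\<lambda>(i, j). if m $ i = m' $ j then real N / 2 else 0)"
  have "mat n n (\<lambda>(i, j). \<Sum>t\<in>F_grid N. sin (pi * of_int (m $ i) * t) * sin (pi * of_int (m' $ j) * t)) = ?G"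
    using m m' by (intro eq_matI) (auto simp: D_hat_def discrete_sine_orthogonality)
  moreover have "det ?G = (real N / 2) ^ n * (if m = m' then 1 else 0)"
  proof (cases "m = m'")
    case True
    have "m $ i \<noteq> m $ j" if "i < n" "j < n" "i \<noteq> j" for i j
      using that dec carrier unfolding strictly_decreasing_vec_def
      by (metis less_irrefl linorder_neqE_nat)
    then have "?G = (real N / 2) \<cdot>\<^sub>m 1\<^sub>m n"
      using True by (intro eq_matI) auto
    then show ?thesis
      using True by simp
  next
    case False
    have "(\<Prod>i=0..<n. ?G $$ (i, p i)) = 0" if p: "p permutes {0..<n}" for p
    proof (rule ccontr)
      assume nz: "(\<Prod>i=0..<n. ?G $$ (i, p i)) \<noteq> 0"
      have eq: "m $ i = m' $ p i" if "i < n" for i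
      proof -
        have "?G $$ (i, p i) \<noteq> 0"
          using nz that by simp
        then show ?thesis
          using that permutes_in_image[OF p, of i] by (simp split: if_splits)
      qed
      then have "p = id"
        using dec carrier p by (intro strictly_decreasing_vec_permute_id[of m m' n]) auto
      then show False
        using eq False carrier by auto
    qed
    then show ?thesis
      using False by (simp add: det_def'[of _ n] del: prod_zero_iff)
  qed
  ultimately show ?thesis by simp
qed

theorem proposition1:
  fixes n N :: nat and m m' :: "int vec"
  assumes "n \<ge> 1" and "N \<ge> 1"
    and "m \<in> D_hat N n" and "m' \<in> D_hat N n"
  shows "(\<Sum>s\<in>F_grid_pow N n. sin_minus n m s * sin_minus n m' s)
           = real (sym_order n) * (\<Sum>s\<in>F_hat N n. sin_minus n m s * sin_minus n m' s) \<and>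
         real (sym_order n) * (\<Sum>s\<in>F_hat N n. sin_minus n m s * sin_minus n m' s)
           = (real N / 2) ^ n * (if m = m' then 1 else 0)"
proof -
  let ?f = "\<lambda>m i t. sin (pi * of_int (m $ i) * t)"
  have pos: "real (sym_order n) \<noteq> 0"
    by (simp add: sym_order_def card_permutations[of _ n])
  have reduce: "(\<Sum>s\<in>F_grid_pow N n. sin_minus n m s * sin_minus n m' s)
      = real (sym_order n) * (\<Sum>s\<in>F_hat N n. sin_minus n m s * sin_minus n m' s)"
    unfolding F_hat_def F_grid_pow_def sym_order_def
  proof (rule sum_symmetric_eq_sum_decreasing[OF finite_F_grid])
    \<comment> \<open>Each determinant picks up the sign of \<open>p\<close>, and the square of the
      sign is 1.\<close>
    fix s :: "real vec" and p assume p: "p permutes {0..<n}"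
    show "sin_minus n m (vec n (\<lambda>i. s $ p i)) * sin_minus n m' (vec n (\<lambda>i. s $ p i))
        = sin_minus n m s * sin_minus n m' s"
      unfolding sin_minus_mult det_permute_arguments[OF p, of "?f m"]
        det_permute_arguments[OF p, of "?f m'"]
      by (cases "evenperm p") (simp_all add: sign_def)
  next
    fix s :: "real vec" assume "\<not> inj_on (($) s) {0..<n}"
    from det_repeated_argument[OF this, of "?f m"]
    show "sin_minus n m s * sin_minus n m' s = 0"
      by (simp add: sin_minus_def)
  qed
  have "(\<Sum>s\<in>F_grid_pow N n. sin_minus n m s * sin_minus n m' s)
      = det (mat n n (\<lambda>(i, j). \<Sum>t\<in>F_grid N. ?f m i t * ?f m' j t))"
    \<comment> \<open>The two normalizing factors multiply to the inverse of
      \<open>sym_order n\<close>, which cancels the factor produced by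
      \<open>andreief\<close>.\<close>
    using pos andreief[OF finite_F_grid[of N], of n "?f m" "?f m'"]
    by (simp add: sin_minus_mult F_grid_pow_def sym_order_def flip: sum_distrib_left)
  then show ?thesis
    using reduce det_sine_gram[OF assms(3,4)] by simp
qed

end
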